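(* Let $H$ be a separable Hilbert space, $\{H_i\}_{i\in I}$ a family of Hilbert spaces, $C$ a bounded invertible operator on $H$ with bounded inverse, and let $\Lambda=\{\Lambda_i\in\mathcal B(H,H_i)\}_{i\in I}$ be a $C^2$-controlled g-frame for $H$ with controlled g-frame operator $S_C$. Put $\Gamma_i:=\Lambda_iCS_C^{-1}$ for $i\in I$. If $f\in H$ has a representation $f=\sum_{i\in I}C^*\Lambda_i^*g_i$ for some $g_i\in H_i$ $(i\in I)$, then $$\sum_{i\in I}\|g_i\|^2=\sum_{i\in I}\|\Gamma_if\|^2+\sum_{i\in I}\|g_i-\Gamma_if\|^2.$$
   Context: $\mathcal B(H,K)$ denotes the bounded linear operators from $H$ to $K$. $\Lambda$ is a $C^2$-controlled g-frame for $H$ (i.e. $(C,C)$-controlled) if there are constants $0<A_C\le B_C<\infty$ with $A_C\|f\|^2\le\sum_{i\in I}\langle\Lambda_iCf,\Lambda_iCf\rangle\le B_C\|f\|^2$ for all $f\in H$. Its controlled g-frame operator is $S_Cf=\sum_{i\in I}C^*\Lambda_i^*\Lambda_iCf$, which is bounded, positive and invertible on $H$. Series of vectors over $I$ converge unconditionally; sums of nonnegative terms take values in $[0,\infty]$. *)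

theory Defs
  imports "HOL-Analysis.Analysis" "HOL-Algebra.Module"
begin

text \<open>
  Hilbert spaces are carrier-based, so that the members of a family \<open>H\<^sub>i\<close> may have different
  carriers and operations; only the ambient element type is shared, and any family of sets
  embeds into one type (for instance by a disjoint union).
  The scalar field is either the reals or the complex numbers, both viewed as subsets of
  the type \<open>complex\<close>; over the reals, inner products take real values and conjugation is
  the identity.
\<close>

definition scalar_ring :: "complex set \<Rightarrow> complex ring" where
  "scalar_ring K = \<lparr>carrier = K, mult = (*), one = 1, zero = 0, add = (+)\<rparr>"

text \<open>
  The fields \<open>mult\<close> and \<open>one\<close> that the record inherits from \<open>module\<close> play no role.
\<close>
record 'a inner_module = "(complex, 'a) module" +
  iprod :: "'a \<Rightarrow> 'a \<Rightarrow> complex"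

definition hnorm :: "('a, 'm) inner_module_scheme \<Rightarrow> 'a \<Rightarrow> real" where
  "hnorm V x = sqrt (Re (iprod V x x))"

text \<open>
  The default value outside the carrier is needed because the library's \<open>Metric_space\<close> demands
  nonnegativity and symmetry of the distance on the whole type.
\<close>
definition hdist :: "('a, 'm) inner_module_scheme \<Rightarrow> 'a \<Rightarrow> 'a \<Rightarrow> real" where
  "hdist V x y =
     (if x \<in> carrier V \<and> y \<in> carrier V then hnorm V (x \<ominus>\<^bsub>V\<^esub> y) else 0)"

definition htopology :: "('a, 'm) inner_module_scheme \<Rightarrow> 'a topology" where
  "htopology V = Metric_space.mtopology (carrier V) (hdist V)"

text \<open>The inner product is linear in the first argument.\<close>
locale hilbert_space = module "scalar_ring K" V
  for K :: "complex set" and V :: "('a, 'm) inner_module_scheme" (structure) +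
  assumes scalars: "K = \<real> \<or> K = UNIV"
    and iprod_closed: "\<lbrakk>x \<in> carrier V; y \<in> carrier V\<rbrakk> \<Longrightarrow> iprod V x y \<in> K"
    and iprod_add: "\<lbrakk>x \<in> carrier V; y \<in> carrier V; z \<in> carrier V\<rbrakk>
      \<Longrightarrow> iprod V (x \<oplus>\<^bsub>V\<^esub> y) z = iprod V x z + iprod V y z"
    and iprod_smult: "\<lbrakk>a \<in> K; x \<in> carrier V; y \<in> carrier V\<rbrakk>
      \<Longrightarrow> iprod V (a \<odot>\<^bsub>V\<^esub> x) y = a * iprod V x y"
    and iprod_commute: "\<lbrakk>x \<in> carrier V; y \<in> carrier V\<rbrakk> \<Longrightarrow> iprod V y x = cnj (iprod V x y)"
    and iprod_pos: "\<lbrakk>x \<in> carrier V; x \<noteq> \<zero>\<^bsub>V\<^esub>\<rbrakk> \<Longrightarrow> 0 < Re (iprod V x x)"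
    and complete: "Metric_space.mcomplete (carrier V) (hdist V)"

text \<open>
  Operators are HOL functions; only their values on the carrier of the domain matter.
\<close>
definition bounded_ops ::
  "complex set \<Rightarrow> ('a, 'm) inner_module_scheme \<Rightarrow> ('b, 'n) inner_module_scheme \<Rightarrow> ('a \<Rightarrow> 'b) set" where
  "bounded_ops K V W = {T. T \<in> carrier V \<rightarrow> carrier W
     \<and> (\<forall>x\<in>carrier V. \<forall>y\<in>carrier V. T (x \<oplus>\<^bsub>V\<^esub> y) = T x \<oplus>\<^bsub>W\<^esub> T y)
     \<and> (\<forall>a\<in>K. \<forall>x\<in>carrier V. T (a \<odot>\<^bsub>V\<^esub> x) = a \<odot>\<^bsub>W\<^esub> T x)
     \<and> (\<exists>M. \<forall>x\<in>carrier V. hnorm W (T x) \<le> M * hnorm V x)}"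

definition adj ::
  "('a, 'm) inner_module_scheme \<Rightarrow> ('b, 'n) inner_module_scheme \<Rightarrow> ('a \<Rightarrow> 'b) \<Rightarrow> 'b \<Rightarrow> 'a" where
  "adj V W T y = (THE z. z \<in> carrier V \<and> (\<forall>x\<in>carrier V. iprod W (T x) y = iprod V x z))"

definition inv_op :: "('a, 'm) inner_module_scheme \<Rightarrow> ('a \<Rightarrow> 'a) \<Rightarrow> 'a \<Rightarrow> 'a" where
  "inv_op V T = inv_into (carrier V) T"

text \<open>Unconditional convergence, as convergence of the net of finite partial sums.\<close>
definition has_usum ::
  "('a, 'm) inner_module_scheme \<Rightarrow> ('i \<Rightarrow> 'a) \<Rightarrow> 'i set \<Rightarrow> 'a \<Rightarrow> bool" where
  "has_usum V u I s \<longleftrightarrow>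
     u \<in> I \<rightarrow> carrier V \<and> limitin (htopology V) (\<lambda>F. finsum V u F) s (finite_subsets_at_top I)"

definition usum :: "('a, 'm) inner_module_scheme \<Rightarrow> ('i \<Rightarrow> 'a) \<Rightarrow> 'i set \<Rightarrow> 'a" where
  "usum V u I = (THE s. has_usum V u I s)"

definition controlled_gframe ::
  "complex set \<Rightarrow> ('a, 'm) inner_module_scheme \<Rightarrow> 'i set \<Rightarrow> ('i \<Rightarrow> ('b, 'n) inner_module_scheme)
     \<Rightarrow> ('a \<Rightarrow> 'a) \<Rightarrow> ('i \<Rightarrow> 'a \<Rightarrow> 'b) \<Rightarrow> bool" where
  "controlled_gframe K H I L C \<Lambda> \<longleftrightarrow>
     (\<forall>i\<in>I. \<Lambda> i \<in> bounded_ops K H (L i)) \<and>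
     (\<exists>A B :: real. 0 < A \<and> A \<le> B \<and>
       (\<forall>f\<in>carrier H.
          ennreal (A * (hnorm H f)\<^sup>2)
            \<le> (\<Sum>\<^sub>\<infinity>i\<in>I. ennreal (Re (iprod (L i) (\<Lambda> i (C f)) (\<Lambda> i (C f)))))
        \<and> (\<Sum>\<^sub>\<infinity>i\<in>I. ennreal (Re (iprod (L i) (\<Lambda> i (C f)) (\<Lambda> i (C f)))))
            \<le> ennreal (B * (hnorm H f)\<^sup>2)))"

definition controlled_gframe_op ::
  "('a, 'm) inner_module_scheme \<Rightarrow> 'i set \<Rightarrow> ('i \<Rightarrow> ('b, 'n) inner_module_scheme)
     \<Rightarrow> ('a \<Rightarrow> 'a) \<Rightarrow> ('i \<Rightarrow> 'a \<Rightarrow> 'b) \<Rightarrow> 'a \<Rightarrow> 'a" where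
  "controlled_gframe_op H I L C \<Lambda> f =
     usum H (\<lambda>i. adj H H C (adj H (L i) (\<Lambda> i) (\<Lambda> i (C f)))) I"

end

theory Submission
  imports Defs
begin

text \<open>
  Let \<open>x = S\<^sub>C\<inverse> f\<close>, so that \<open>\<Gamma>\<^sub>i f = \<Lambda>\<^sub>i C x\<close>. Taking the inner product with \<open>x\<close> in
  \<open>f = \<Sum> C\<^sup>* \<Lambda>\<^sub>i\<^sup>* g\<^sub>i\<close> and in \<open>f = S\<^sub>C x\<close> gives \<open>\<Sum> \<langle>g\<^sub>i - \<Gamma>\<^sub>i f, \<Gamma>\<^sub>i f\<rangle> = 0\<close>, and the identity is
  Pythagoras' theorem. Adjoints come from the Riesz representation theorem, and \<open>S\<^sub>C\<close> is
  surjective because the form \<open>\<langle>S\<^sub>C x, y\<rangle>\<close> is Hermitian, bounded and coercive; both are instances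
  of one variational argument.
\<close>

section \<open>Representation theorems in Hilbert spaces\<close>

context hilbert_space
begin

section \<open>Inner product algebra, norm and the Cauchy-Schwarz inequality\<close>

lemma of_real_scalar: "complex_of_real r \<in> K"
  using scalars by auto

lemma smult_mem [simp]: "a \<in> K \<Longrightarrow> x \<in> carrier V \<Longrightarrow> a \<odot>\<^bsub>V\<^esub> x \<in> carrier V"
  using smult_closed[of a x] by (simp add: scalar_ring_def)

lemma minus_add_cancel: "\<lbrakk>x \<in> carrier V; y \<in> carrier V\<rbrakk> \<Longrightarrow> (x \<ominus>\<^bsub>V\<^esub> y) \<oplus>\<^bsub>V\<^esub> y = x"
  by (simp add: a_minus_def a_assoc l_neg)

lemma minus_eq_zero_iff:
  "\<lbrakk>x \<in> carrier V; y \<in> carrier V\<rbrakk> \<Longrightarrow> x \<ominus>\<^bsub>V\<^esub> y = \<zero>\<^bsub>V\<^esub> \<longleftrightarrow> x = y"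
  using minus_add_cancel[of x y] by (auto simp: a_minus_def r_neg)

lemma iprod_zero_left [simp]: "y \<in> carrier V \<Longrightarrow> iprod V \<zero>\<^bsub>V\<^esub> y = 0"
  using iprod_add[of "\<zero>\<^bsub>V\<^esub>" "\<zero>\<^bsub>V\<^esub>" y] by simp

lemma iprod_minus:
  assumes "x \<in> carrier V" "y \<in> carrier V" "z \<in> carrier V"
  shows "iprod V (x \<ominus>\<^bsub>V\<^esub> y) z = iprod V x z - iprod V y z"
  using iprod_add[of "x \<ominus>\<^bsub>V\<^esub> y" y z] assms by (simp add: minus_add_cancel)

lemma iprod_zero_right [simp]: "y \<in> carrier V \<Longrightarrow> iprod V y \<zero>\<^bsub>V\<^esub> = 0"
  using iprod_commute[of "\<zero>\<^bsub>V\<^esub>" y] by simp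

lemma iprod_add_right:
  "\<lbrakk>x \<in> carrier V; y \<in> carrier V; z \<in> carrier V\<rbrakk>
    \<Longrightarrow> iprod V z (x \<oplus>\<^bsub>V\<^esub> y) = iprod V z x + iprod V z y"
  using iprod_commute[of "x \<oplus>\<^bsub>V\<^esub> y" z] iprod_commute[of x z] iprod_commute[of y z] iprod_add[of x y z]
  by simp

lemma iprod_minus_right:
  "\<lbrakk>x \<in> carrier V; y \<in> carrier V; z \<in> carrier V\<rbrakk>
    \<Longrightarrow> iprod V z (x \<ominus>\<^bsub>V\<^esub> y) = iprod V z x - iprod V z y"
  using iprod_commute[of "x \<ominus>\<^bsub>V\<^esub> y" z] iprod_commute[of x z] iprod_commute[of y z] iprod_minus[of x y z]
  by simp

lemma iprod_smult_right:
  "\<lbrakk>a \<in> K; x \<in> carrier V; y \<in> carrier V\<rbrakk> \<Longrightarrow> iprod V y (a \<odot>\<^bsub>V\<^esub> x) = cnj a * iprod V y x"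
  using iprod_commute[of "a \<odot>\<^bsub>V\<^esub> x" y] iprod_commute[of x y] iprod_smult[of a x y]
  by simp

lemma iprod_finsum:
  assumes "finite F" "u \<in> F \<rightarrow> carrier V" "y \<in> carrier V"
  shows "iprod V (finsum V u F) y = (\<Sum>i\<in>F. iprod V (u i) y)"
  using assms by (induction F) (auto simp: iprod_add Pi_def finsum_insert finsum_closed)

lemma Re_iprod_nonneg: "x \<in> carrier V \<Longrightarrow> 0 \<le> Re (iprod V x x)"
  using iprod_pos[of x] by (cases "x = \<zero>\<^bsub>V\<^esub>") auto

lemma hnorm_nonneg [simp]: "x \<in> carrier V \<Longrightarrow> 0 \<le> hnorm V x"
  by (simp add: hnorm_def Re_iprod_nonneg)

lemma hnorm_power2: "x \<in> carrier V \<Longrightarrow> (hnorm V x)\<^sup>2 = Re (iprod V x x)"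
  by (simp add: hnorm_def Re_iprod_nonneg)

text \<open>By conjugate symmetry \<open>iprod V x x\<close> equals its own conjugate, so its
  imaginary part vanishes.\<close>

lemma iprod_self:
  assumes "x \<in> carrier V"
  shows "iprod V x x = complex_of_real ((hnorm V x)\<^sup>2)"
proof -
  have "Im (iprod V x x) = - Im (iprod V x x)"
    using iprod_commute[OF assms assms] by (metis cnj.simps(2))
  then show ?thesis using hnorm_power2[OF assms] by (simp add: complex_eq_iff)
qed

lemma hnorm_eq_0_iff: "x \<in> carrier V \<Longrightarrow> hnorm V x = 0 \<longleftrightarrow> x = \<zero>\<^bsub>V\<^esub>"
  using iprod_pos[of x] by (cases "x = \<zero>\<^bsub>V\<^esub>") (auto simp: hnorm_def)

lemma hnorm_minus_power2:
  assumes "x \<in> carrier V" "y \<in> carrier V"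
  shows "(hnorm V (x \<ominus>\<^bsub>V\<^esub> y))\<^sup>2 = (hnorm V x)\<^sup>2 + (hnorm V y)\<^sup>2 - 2 * Re (iprod V x y)"
  using assms iprod_commute[of x y]
  by (simp add: hnorm_power2 iprod_minus iprod_minus_right)

text \<open>Expand 0 \<le> ||n x - a y||^2 with n = ||y||^2 and a = <x, y>. Scaling \<open>x\<close>
  by \<open>n\<close>, instead of dividing \<open>a\<close> by it, keeps the computation free of
  inverses in \<open>K\<close>; the positive factor \<open>n\<close> is cancelled only at the
  end.\<close>

lemma Cauchy_Schwarz:
  assumes "x \<in> carrier V" "y \<in> carrier V"
  shows "cmod (iprod V x y) \<le> hnorm V x * hnorm V y"
proof (cases "y = \<zero>\<^bsub>V\<^esub>")
  case True
  then show ?thesis using assms by simp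
next
  case False
  then have pos: "0 < hnorm V y"
    using assms hnorm_eq_0_iff hnorm_nonneg by (metis order_le_less)
  define a n where "a = iprod V x y" and "n = (hnorm V y)\<^sup>2"
  have aK: "a \<in> K" using assms iprod_closed by (simp add: a_def)
  have nK: "complex_of_real n \<in> K" by (rule of_real_scalar)
  define p q where "p = complex_of_real n \<odot>\<^bsub>V\<^esub> x" and "q = a \<odot>\<^bsub>V\<^esub> y"
  have pq: "p \<in> carrier V" "q \<in> carrier V" using aK nK assms by (auto simp: p_def q_def)
  have "(hnorm V p)\<^sup>2 = n\<^sup>2 * (hnorm V x)\<^sup>2"
    using pq assms nK by (simp add: p_def hnorm_power2 iprod_smult iprod_smult_right power2_eq_square[of n])
  moreover have "(hnorm V q)\<^sup>2 = (cmod a)\<^sup>2 * n"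
  proof -
    have "iprod V q q = a * cnj a * complex_of_real n"
      using pq assms aK by (simp add: q_def iprod_smult iprod_smult_right iprod_self[OF assms(2)] n_def)
    also have "\<dots> = complex_of_real ((cmod a)\<^sup>2 * n)"
      by (simp flip: complex_norm_square)
    finally show ?thesis using pq by (simp add: hnorm_power2)
  qed
  moreover have "Re (iprod V p q) = n * (cmod a)\<^sup>2"
  proof -
    have "iprod V p q = complex_of_real n * (a * cnj a)"
      using pq assms aK nK by (simp add: p_def q_def iprod_smult iprod_smult_right a_def)
    then show ?thesis
      by (simp flip: complex_norm_square)
  qed
  ultimately have "0 \<le> n\<^sup>2 * (hnorm V x)\<^sup>2 + (cmod a)\<^sup>2 * n - 2 * (n * (cmod a)\<^sup>2)"
    using hnorm_minus_power2[OF pq] zero_le_power2[of "hnorm V (p \<ominus>\<^bsub>V\<^esub> q)"] by simp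
  then have "n * (cmod a)\<^sup>2 \<le> n * (n * (hnorm V x)\<^sup>2)"
    by (simp add: algebra_simps power2_eq_square)
  moreover have "0 < n" using pos by (simp add: n_def)
  ultimately have "(cmod a)\<^sup>2 \<le> n * (hnorm V x)\<^sup>2" by simp
  then have "(cmod a)\<^sup>2 \<le> (hnorm V x * hnorm V y)\<^sup>2"
    by (simp add: n_def power_mult_distrib mult.commute)
  then show ?thesis
    using assms by (simp add: a_def power2_le_iff_abs_le abs_le_square_iff[symmetric])
qed

section \<open>The induced metric, continuity and unconditional sums\<close>

lemma hnorm_minus_commute:
  "\<lbrakk>x \<in> carrier V; y \<in> carrier V\<rbrakk> \<Longrightarrow> hnorm V (x \<ominus>\<^bsub>V\<^esub> y) = hnorm V (y \<ominus>\<^bsub>V\<^esub> x)"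
  by (simp add: hnorm_def iprod_minus iprod_minus_right algebra_simps)

lemma hnorm_triangle:
  assumes "x \<in> carrier V" "y \<in> carrier V"
  shows "hnorm V (x \<oplus>\<^bsub>V\<^esub> y) \<le> hnorm V x + hnorm V y"
proof (rule power2_le_imp_le)
  have "(hnorm V (x \<oplus>\<^bsub>V\<^esub> y))\<^sup>2 = (hnorm V x)\<^sup>2 + (hnorm V y)\<^sup>2 + 2 * Re (iprod V x y)"
    using assms iprod_commute[of x y] by (simp add: hnorm_power2 iprod_add iprod_add_right)
  also have "\<dots> \<le> (hnorm V x)\<^sup>2 + (hnorm V y)\<^sup>2 + 2 * (hnorm V x * hnorm V y)"
    using Cauchy_Schwarz[OF assms] complex_Re_le_cmod[of "iprod V x y"] by simp
  finally show "(hnorm V (x \<oplus>\<^bsub>V\<^esub> y))\<^sup>2 \<le> (hnorm V x + hnorm V y)\<^sup>2"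
    by (simp add: power2_sum)
qed (use assms in simp)

lemma hdist_metric: "Metric_space (carrier V) (hdist V)"
proof
  fix x y z
  assume xyz: "x \<in> carrier V" "y \<in> carrier V" "z \<in> carrier V"
  have "(x \<ominus>\<^bsub>V\<^esub> y) \<oplus>\<^bsub>V\<^esub> (y \<ominus>\<^bsub>V\<^esub> z) = x \<ominus>\<^bsub>V\<^esub> z"
    using xyz by (simp add: a_minus_def a_assoc r_neg1)
  then show "hdist V x z \<le> hdist V x y + hdist V y z"
    using xyz hnorm_triangle[of "x \<ominus>\<^bsub>V\<^esub> y" "y \<ominus>\<^bsub>V\<^esub> z"] by (simp add: hdist_def)
next
  fix x y
  assume xy: "x \<in> carrier V" "y \<in> carrier V"
  then have "hdist V x y = 0 \<longleftrightarrow> x \<ominus>\<^bsub>V\<^esub> y = \<zero>\<^bsub>V\<^esub>"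
    by (simp add: hdist_def hnorm_eq_0_iff)
  then show "hdist V x y = 0 \<longleftrightarrow> x = y" using xy by (simp add: minus_eq_zero_iff)
qed (auto simp: hdist_def hnorm_minus_commute)

interpretation M: Metric_space "carrier V" "hdist V"
  by (rule hdist_metric)

lemma limitin_htopology:
  "limitin (htopology V) u s F \<longleftrightarrow> s \<in> carrier V \<and> eventually (\<lambda>n. u n \<in> carrier V) F
     \<and> ((\<lambda>n. hdist V (u n) s) \<longlongrightarrow> 0) F"
  by (simp add: htopology_def M.limitin_metric_dist_null)

text \<open>The functional <_, y> is Lipschitz with constant ||y||, by Cauchy-Schwarz applied to the
  difference of \<open>u n\<close> and \<open>s\<close>.\<close>

lemma limitin_iprod:
  assumes "limitin (htopology V) u s F" "y \<in> carrier V"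
  shows "((\<lambda>n. iprod V (u n) y) \<longlongrightarrow> iprod V s y) F"
proof -
  have s: "s \<in> carrier V" and ev: "eventually (\<lambda>n. u n \<in> carrier V) F"
    and lim: "((\<lambda>n. hdist V (u n) s) \<longlongrightarrow> 0) F"
    using assms by (auto simp: limitin_htopology)
  have "((\<lambda>n. iprod V (u n) y - iprod V s y) \<longlongrightarrow> 0) F"
  proof (rule Lim_null_comparison)
    show "eventually (\<lambda>n. norm (iprod V (u n) y - iprod V s y) \<le> hdist V (u n) s * hnorm V y) F"
      using ev
    proof eventually_elim
      case (elim n)
      then show ?case
        using Cauchy_Schwarz[of "u n \<ominus>\<^bsub>V\<^esub> s" y] s assms(2) by (simp add: hdist_def iprod_minus)
    qed
    show "((\<lambda>n. hdist V (u n) s * hnorm V y) \<longlongrightarrow> 0) F"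
      using tendsto_mult_right[OF lim, of "hnorm V y"] by simp
  qed
  then show ?thesis by (simp add: LIM_zero_iff)
qed

text \<open>Continuity is applied to the finite partial sums, on which the inner product is
  additive. This is how the two representations of \<open>f\<close> are later tested against
  \<open>x\<close>.\<close>

lemma has_usum_iprod:
  assumes "has_usum V u I s" "y \<in> carrier V"
  shows "((\<lambda>i. iprod V (u i) y) has_sum iprod V s y) I"
proof -
  have u: "u \<in> I \<rightarrow> carrier V"
    and lim: "limitin (htopology V) (\<lambda>F. finsum V u F) s (finite_subsets_at_top I)"
    using assms by (auto simp: has_usum_def)
  have "eventually (\<lambda>F. iprod V (finsum V u F) y = (\<Sum>i\<in>F. iprod V (u i) y)) (finite_subsets_at_top I)"
    using u assms(2) by (intro eventually_finite_subsets_at_top_weakI iprod_finsum) auto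
  then show ?thesis
    using limitin_iprod[OF lim assms(2)] unfolding has_sum_def by (rule Lim_transform_eventually[rotated])
qed

text \<open>Limits along a nontrivial filter in a metric space are unique, so exhibiting one sum
  settles the definite description in \<open>usum\<close>.\<close>

lemma has_usum_usum:
  assumes "has_usum V u I s"
  shows "usum V u I = s"
  unfolding usum_def
proof (rule the_equality)
  show "has_usum V u I s" by (rule assms)
next
  fix t assume "has_usum V u I t"
  with assms show "t = s"
    using M.limitin_metric_unique[of "\<lambda>F. finsum V u F" t "finite_subsets_at_top I" s]
    by (auto simp: has_usum_def htopology_def)
qed

text \<open>
  The representing vector minimises \<open>\<lambda>x. Re (b x x) - 2 * Re (\<phi> x)\<close>: coercivity makes every
  minimising sequence Cauchy, and the first variation at the minimum vanishes.
\<close>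
lemma coercive_form_representation:
  assumes b_closed: "\<And>x y. \<lbrakk>x \<in> carrier V; y \<in> carrier V\<rbrakk> \<Longrightarrow> b x y \<in> K"
    and b_add: "\<And>x y z. \<lbrakk>x \<in> carrier V; y \<in> carrier V; z \<in> carrier V\<rbrakk>
      \<Longrightarrow> b (x \<oplus>\<^bsub>V\<^esub> y) z = b x z + b y z"
    and b_smult: "\<And>a x y. \<lbrakk>a \<in> K; x \<in> carrier V; y \<in> carrier V\<rbrakk> \<Longrightarrow> b (a \<odot>\<^bsub>V\<^esub> x) y = a * b x y"
    and b_commute: "\<And>x y. \<lbrakk>x \<in> carrier V; y \<in> carrier V\<rbrakk> \<Longrightarrow> b y x = cnj (b x y)"
    and b_bound: "\<And>x y. \<lbrakk>x \<in> carrier V; y \<in> carrier V\<rbrakk> \<Longrightarrow> cmod (b x y) \<le> B * (hnorm V x * hnorm V y)"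
    and A: "0 < A"
    and b_coercive: "\<And>x. x \<in> carrier V \<Longrightarrow> A * (hnorm V x)\<^sup>2 \<le> Re (b x x)"
    and \<phi>_closed: "\<And>x. x \<in> carrier V \<Longrightarrow> \<phi> x \<in> K"
    and \<phi>_add: "\<And>x y. \<lbrakk>x \<in> carrier V; y \<in> carrier V\<rbrakk> \<Longrightarrow> \<phi> (x \<oplus>\<^bsub>V\<^esub> y) = \<phi> x + \<phi> y"
    and \<phi>_smult: "\<And>a x. \<lbrakk>a \<in> K; x \<in> carrier V\<rbrakk> \<Longrightarrow> \<phi> (a \<odot>\<^bsub>V\<^esub> x) = a * \<phi> x"
    and \<phi>_bound: "\<And>x. x \<in> carrier V \<Longrightarrow> cmod (\<phi> x) \<le> M * hnorm V x"
  shows "\<exists>z\<in>carrier V. \<forall>x\<in>carrier V. \<phi> x = b x z"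
proof -
  \<comment> \<open>If \<open>b\<close> is the inner product and \<phi> = <_, f>, then J x = ||x -
    f||^2 - ||f||^2, so that minimising \<open>J\<close> generalises best approximation of
    \<open>f\<close>.\<close>
  define J where "J = (\<lambda>x. Re (b x x) - 2 * Re (\<phi> x))"
  have b_add_right: "b z (x \<oplus>\<^bsub>V\<^esub> y) = b z x + b z y"
    if "x \<in> carrier V" "y \<in> carrier V" "z \<in> carrier V" for x y z
    using b_commute[of "x \<oplus>\<^bsub>V\<^esub> y" z] b_commute[of x z] b_commute[of y z] b_add[of x y z] that by simp
  \<comment> \<open>On a real line \<open>J\<close> is a quadratic polynomial in \<open>t\<close>.
    The values 1 and 1/2 of \<open>t\<close> give the gap estimate, arbitrary \<open>t\<close> the
    first variation; real \<open>t\<close> is a scalar over both fields.\<close>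
  have expand: "J (x \<oplus>\<^bsub>V\<^esub> (complex_of_real t \<odot>\<^bsub>V\<^esub> w))
      = J x + t\<^sup>2 * Re (b w w) + 2 * t * (Re (b w x) - Re (\<phi> w))"
    if x: "x \<in> carrier V" and w: "w \<in> carrier V" for x w t
  proof -
    define v where "v = complex_of_real t \<odot>\<^bsub>V\<^esub> w"
    have v: "v \<in> carrier V" using w of_real_scalar by (simp add: v_def)
    have vy: "b v y = complex_of_real t * b w y" if "y \<in> carrier V" for y
      using that w of_real_scalar by (simp add: v_def b_smult)
    have "b v v = complex_of_real t * (complex_of_real t * cnj (b w w))"
      using vy[OF v] b_commute[OF v w] vy[OF w] by simp
    moreover have "\<phi> v = complex_of_real t * \<phi> w"
      using w of_real_scalar by (simp add: v_def \<phi>_smult)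
    ultimately show ?thesis
      using x v vy[OF x] b_commute[OF v x]
      by (simp add: J_def b_add b_add_right \<phi>_add power2_eq_square algebra_simps flip: v_def)
  qed
  \<comment> \<open>The bound is the minimum of A n^2 - 2 M n over real n, found by completing the
    square.\<close>
  have J_below: "- (M\<^sup>2 / A) \<le> J x" if "x \<in> carrier V" for x
  proof -
    define n where "n = hnorm V x"
    have "Re (\<phi> x) \<le> M * n"
      using \<phi>_bound[OF that] complex_Re_le_cmod[of "\<phi> x"] by (simp add: n_def)
    then have "A * n\<^sup>2 - 2 * (M * n) \<le> J x"
      using b_coercive[OF that] by (simp add: J_def n_def)
    moreover have "- (M\<^sup>2 / A) \<le> A * n\<^sup>2 - 2 * (M * n)"
    proof -
      have "A * n\<^sup>2 - 2 * (M * n) + M\<^sup>2 / A = (A * n - M)\<^sup>2 / A"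
        using A by (simp add: field_simps power2_eq_square)
      also have "\<dots> \<ge> 0" using A by simp
      finally show ?thesis by simp
    qed
    ultimately show ?thesis by simp
  qed
  define m where "m = Inf (J ` carrier V)"
  have bdd: "bdd_below (J ` carrier V)"
    using J_below by (intro bdd_belowI2)
  have m_le: "m \<le> J x" if "x \<in> carrier V" for x
    unfolding m_def using bdd that by (intro cINF_lower)
  have "\<exists>x\<in>carrier V. J x < m + 1 / real (Suc n)" for n
    using cINF_less_iff[OF _ bdd, of "m + 1 / real (Suc n)"] zero_closed unfolding m_def by fastforce
  then obtain xs where xs: "\<And>n. xs n \<in> carrier V" and xs_J: "\<And>n. J (xs n) < m + 1 / real (Suc n)"
    by metis
  \<comment> \<open>With w = y - x, the midpoint has J x + J y - 2 J(midpoint) = Re (b w w) / 2, the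
    parallelogram law for \<open>b\<close>. Its value of \<open>J\<close> is at least
    \<open>m\<close>, and coercivity turns Re (b w w) into a multiple of the squared
    distance.\<close>
  have gap: "A / 2 * (hdist V x y)\<^sup>2 \<le> J x + J y - 2 * m" if "x \<in> carrier V" "y \<in> carrier V" for x y
  proof -
    define w where "w = y \<ominus>\<^bsub>V\<^esub> x"
    have w: "w \<in> carrier V" using that by (simp add: w_def)
    have "x \<oplus>\<^bsub>V\<^esub> w = y"
      using that minus_add_cancel[of y x] by (simp add: w_def add.m_comm)
    moreover have "1 \<odot>\<^bsub>V\<^esub> w = w" using w smult_one[of w] by (simp add: scalar_ring_def)
    ultimately have Jy: "J y = J x + Re (b w w) + 2 * (Re (b w x) - Re (\<phi> w))"
      using expand[OF that(1) w, of 1] by simp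
    have "m \<le> J (x \<oplus>\<^bsub>V\<^esub> (complex_of_real (1/2) \<odot>\<^bsub>V\<^esub> w))"
      using that(1) w by (intro m_le) (simp only: smult_mem of_real_scalar add.m_closed)
    also have "\<dots> = J x + Re (b w w) / 4 + (Re (b w x) - Re (\<phi> w))"
      using expand[OF that(1) w, of "1/2"] by (simp only:) (simp add: power2_eq_square)
    finally have "Re (b w w) / 2 \<le> J x + J y - 2 * m" using Jy by simp
    moreover have "A * (hdist V x y)\<^sup>2 \<le> Re (b w w)"
      using b_coercive[OF w] that by (simp add: hdist_def w_def hnorm_minus_commute[of x y])
    ultimately show ?thesis by simp
  qed
  have "M.MCauchy xs"
    unfolding M.MCauchy_def
  proof (intro conjI allI impI)
    show "range xs \<subseteq> carrier V" using xs by auto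
    fix \<epsilon> :: real assume \<epsilon>: "0 < \<epsilon>"
    \<comment> \<open>For indices beyond \<open>N\<close>, \<open>gap\<close> bounds A/2 times the
      squared distance by 2 / (N + 1), and the factor 1/4 makes this less than A \<epsilon>^2 /
      2.\<close>
    obtain N where N: "1 / real (Suc N) < A * \<epsilon>\<^sup>2 / 4"
      using A \<epsilon> by (metis divide_pos_pos mult_pos_pos nat_approx_posE zero_less_numeral zero_less_power)
    show "\<exists>N. \<forall>n n'. N \<le> n \<longrightarrow> N \<le> n' \<longrightarrow> hdist V (xs n) (xs n') < \<epsilon>"
    proof (intro exI allI impI)
      fix n n' assume n: "N \<le> n" "N \<le> n'"
      have le: "1 / real (Suc k) \<le> 1 / real (Suc N)" if "N \<le> k" for k
        using that by (simp add: frac_le)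
      have "A / 2 * (hdist V (xs n) (xs n'))\<^sup>2 < A * \<epsilon>\<^sup>2 / 2"
        using gap[OF xs xs, of n n'] xs_J[of n] xs_J[of n'] le[OF n(1)] le[OF n(2)] N by linarith
      then have "(hdist V (xs n) (xs n'))\<^sup>2 < \<epsilon>\<^sup>2" using A by simp
      then show "hdist V (xs n) (xs n') < \<epsilon>"
        using \<epsilon> by (simp add: power2_less_imp_less)
    qed
  qed
  then obtain z where z_lim: "limitin (htopology V) xs z sequentially"
    using complete unfolding M.mcomplete_def htopology_def by blast
  then have z: "z \<in> carrier V" and z_dist: "(\<lambda>n. hdist V (xs n) z) \<longlonglongrightarrow> 0"
    by (auto simp: limitin_htopology)
  \<comment> \<open>\<open>J\<close> involves only real parts and \<open>t\<close> is real, so the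
    first variation yields equality of real parts only. It is carried out at \<open>xs n\<close>,
    and then \<open>b w (xs n)\<close> passes to its limit; the value \<open>J z\<close> does not
    enter.\<close>
  have Re_eq: "Re (\<phi> w) = Re (b w z)" if w: "w \<in> carrier V" for w
  proof -
    have "(\<lambda>n. b w (xs n) - b w z) \<longlonglongrightarrow> 0"
    proof (rule Lim_null_comparison)
      have "norm (b w (xs n) - b w z) \<le> B * (hnorm V w * hdist V (xs n) z)" for n
      proof -
        have "(xs n \<ominus>\<^bsub>V\<^esub> z) \<oplus>\<^bsub>V\<^esub> z = xs n"
          using z xs by (simp add: minus_add_cancel)
        then have "b w (xs n) - b w z = b w (xs n \<ominus>\<^bsub>V\<^esub> z)"
          using b_add_right[of "xs n \<ominus>\<^bsub>V\<^esub> z" z w] w z xs by simp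
        then show ?thesis using b_bound[OF w, of "xs n \<ominus>\<^bsub>V\<^esub> z"] xs z by (simp add: hdist_def)
      qed
      then show "\<forall>\<^sub>F n in sequentially. norm (b w (xs n) - b w z) \<le> B * (hnorm V w * hdist V (xs n) z)"
        by simp
      show "(\<lambda>n. B * (hnorm V w * hdist V (xs n) z)) \<longlonglongrightarrow> 0"
        using tendsto_mult_left[OF tendsto_mult_left[OF z_dist, of "hnorm V w"], of B] by simp
    qed
    then have lim: "(\<lambda>n. Re (b w (xs n))) \<longlonglongrightarrow> Re (b w z)"
      by (intro tendsto_Re) (simp add: LIM_zero_iff)
    define \<alpha> c where "\<alpha> = Re (b w w)" and "c = Re (b w z) - Re (\<phi> w)"
    have \<alpha>: "0 \<le> \<alpha>"
      using b_coercive[OF w] A by (smt (verit) \<alpha>_def mult_nonneg_nonneg zero_le_power2)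
    \<comment> \<open>At \<open>xs n\<close> the increment of \<open>J\<close> in direction t w is
      at least m - J (xs n), which exceeds - 1 / (n + 1). Letting n grow leaves a nonnegative
      quadratic in \<open>t\<close>.\<close>
    have nonneg: "0 \<le> t\<^sup>2 * \<alpha> + 2 * t * c" for t
    proof (rule LIMSEQ_le)
      show "(\<lambda>n. - (1 / real (Suc n))) \<longlonglongrightarrow> 0"
        using tendsto_minus[OF LIMSEQ_inverse_real_of_nat] by (simp add: inverse_eq_divide)
      show "(\<lambda>n. t\<^sup>2 * \<alpha> + 2 * t * (Re (b w (xs n)) - Re (\<phi> w))) \<longlonglongrightarrow> t\<^sup>2 * \<alpha> + 2 * t * c"
        unfolding c_def by (intro tendsto_intros lim)
      have "- (1 / real (Suc n)) \<le> t\<^sup>2 * \<alpha> + 2 * t * (Re (b w (xs n)) - Re (\<phi> w))" for n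
      proof -
        have "m \<le> J (xs n \<oplus>\<^bsub>V\<^esub> (complex_of_real t \<odot>\<^bsub>V\<^esub> w))"
          using xs w of_real_scalar by (intro m_le) simp
        then show ?thesis using expand[OF xs w, of n t] xs_J[of n] unfolding \<alpha>_def by linarith
      qed
      then show "\<exists>N. \<forall>n\<ge>N. - (1 / real (Suc n)) \<le> t\<^sup>2 * \<alpha> + 2 * t * (Re (b w (xs n)) - Re (\<phi> w))"
        by blast
    qed
    \<comment> \<open>The vertex of the quadratic is at - c / \<alpha>; the denominator \<alpha> + 1
      also covers \<alpha> = 0 and still gives a negative value unless c = 0.\<close>
    have "(- c / (\<alpha> + 1))\<^sup>2 * \<alpha> + 2 * (- c / (\<alpha> + 1)) * c = - (c\<^sup>2 * (\<alpha> + 2) / (\<alpha> + 1)\<^sup>2)"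
      using \<alpha> by (simp add: divide_simps power2_eq_square) (simp add: algebra_simps)
    with nonneg[of "- c / (\<alpha> + 1)"] have "c\<^sup>2 * (\<alpha> + 2) / (\<alpha> + 1)\<^sup>2 \<le> 0" by simp
    then have "c\<^sup>2 \<le> 0"
      using \<alpha> by (simp add: divide_le_0_iff mult_le_0_iff)
    then show ?thesis by (simp add: c_def)
  qed
  \<comment> \<open>Over the complex numbers, equality of real parts at \<i> w supplies equality of
    imaginary parts at \<open>w\<close>.\<close>
  have "\<phi> w = b w z" if w: "w \<in> carrier V" for w
    using scalars
  proof
    assume "K = \<real>"
    with b_closed[OF w z] \<phi>_closed[OF w] have "b w z \<in> \<real>" "\<phi> w \<in> \<real>" by simp_all
    then show ?thesis using Re_eq[OF w] by (simp add: complex_eq_iff complex_is_Real_iff)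
  next
    assume "K = UNIV"
    then have i: "\<i> \<in> K" by simp
    then have "Re (\<i> * \<phi> w) = Re (\<i> * b w z)"
      using Re_eq[of "\<i> \<odot>\<^bsub>V\<^esub> w"] w z by (simp only: \<phi>_smult b_smult smult_mem)
    then show ?thesis using Re_eq[OF w] by (simp add: complex_eq_iff)
  qed
  with z show ?thesis by blast
qed

text \<open>The form is the inner product itself: it is bounded by Cauchy-Schwarz and coercive with
  equality, both with constant 1.\<close>

corollary Riesz_representation:
  assumes "\<And>x. x \<in> carrier V \<Longrightarrow> \<phi> x \<in> K"
    and "\<And>x y. \<lbrakk>x \<in> carrier V; y \<in> carrier V\<rbrakk> \<Longrightarrow> \<phi> (x \<oplus>\<^bsub>V\<^esub> y) = \<phi> x + \<phi> y"
    and "\<And>a x. \<lbrakk>a \<in> K; x \<in> carrier V\<rbrakk> \<Longrightarrow> \<phi> (a \<odot>\<^bsub>V\<^esub> x) = a * \<phi> x"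
    and "\<And>x. x \<in> carrier V \<Longrightarrow> cmod (\<phi> x) \<le> M * hnorm V x"
  shows "\<exists>z\<in>carrier V. \<forall>x\<in>carrier V. \<phi> x = iprod V x z"
proof (rule coercive_form_representation[where A = 1 and B = 1 and M = M])
  show "\<And>x y. \<lbrakk>x \<in> carrier V; y \<in> carrier V\<rbrakk> \<Longrightarrow> cmod (iprod V x y) \<le> 1 * (hnorm V x * hnorm V y)"
    using Cauchy_Schwarz by simp
  show "\<And>x. x \<in> carrier V \<Longrightarrow> 1 * (hnorm V x)\<^sup>2 \<le> Re (iprod V x x)"
    by (simp add: hnorm_power2)
qed (use assms in \<open>auto simp: iprod_closed iprod_add iprod_smult intro: iprod_commute\<close>)

section \<open>Uniqueness of representing vectors and adjoints\<close>

lemma iprod_right_unique: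
  assumes "y \<in> carrier V" "z \<in> carrier V" "\<And>x. x \<in> carrier V \<Longrightarrow> iprod V x y = iprod V x z"
  shows "y = z"
proof -
  have "iprod V (y \<ominus>\<^bsub>V\<^esub> z) (y \<ominus>\<^bsub>V\<^esub> z) = 0"
    using assms by (simp add: iprod_minus_right)
  then have "hnorm V (y \<ominus>\<^bsub>V\<^esub> z) = 0" by (simp add: hnorm_def)
  then show ?thesis using assms by (simp add: hnorm_eq_0_iff minus_eq_zero_iff)
qed

text \<open>Riesz representation of x \<mapsto> <T x, y>, which is bounded because \<open>T\<close>
  is, gives existence; with uniqueness this justifies the definite description in
  \<open>adj\<close>.\<close>

lemma adj_spec:
  assumes W: "hilbert_space K W" and T: "T \<in> bounded_ops K V W" and y: "y \<in> carrier W"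
  shows adj_closed: "adj V W T y \<in> carrier V"
    and iprod_adj: "x \<in> carrier V \<Longrightarrow> iprod V x (adj V W T y) = iprod W (T x) y"
proof -
  interpret W: hilbert_space K W by (rule W)
  have Tc: "\<And>x. x \<in> carrier V \<Longrightarrow> T x \<in> carrier W"
    and T_lin: "\<And>x y. \<lbrakk>x \<in> carrier V; y \<in> carrier V\<rbrakk> \<Longrightarrow> T (x \<oplus>\<^bsub>V\<^esub> y) = T x \<oplus>\<^bsub>W\<^esub> T y"
       "\<And>a x. \<lbrakk>a \<in> K; x \<in> carrier V\<rbrakk> \<Longrightarrow> T (a \<odot>\<^bsub>V\<^esub> x) = a \<odot>\<^bsub>W\<^esub> T x"
    using T by (auto simp: bounded_ops_def)
  obtain M where M: "\<And>x. x \<in> carrier V \<Longrightarrow> hnorm W (T x) \<le> M * hnorm V x"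
    using T unfolding bounded_ops_def by blast
  have "\<exists>z\<in>carrier V. \<forall>x\<in>carrier V. iprod W (T x) y = iprod V x z"
  proof (rule Riesz_representation[where M = "M * hnorm W y"])
    fix x assume x: "x \<in> carrier V"
    have "cmod (iprod W (T x) y) \<le> hnorm W (T x) * hnorm W y"
      using W.Cauchy_Schwarz[OF Tc[OF x] y] .
    also have "\<dots> \<le> (M * hnorm V x) * hnorm W y"
      using M[OF x] y by (intro mult_right_mono) auto
    finally show "cmod (iprod W (T x) y) \<le> M * hnorm W y * hnorm V x" by (simp add: mult_ac)
  qed (use Tc T_lin y W.iprod_closed W.iprod_add W.iprod_smult in auto)
  then have "\<exists>!z. z \<in> carrier V \<and> (\<forall>x\<in>carrier V. iprod W (T x) y = iprod V x z)"
    using iprod_right_unique by (metis (no_types, lifting))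
  from theI'[OF this] show "adj V W T y \<in> carrier V"
    and "x \<in> carrier V \<Longrightarrow> iprod V x (adj V W T y) = iprod W (T x) y"
    by (auto simp: adj_def)
qed

end

section \<open>Infinite sums\<close>

text \<open>On nonnegative reals \<open>ennreal\<close> is additive and continuous, so it commutes
  with the limit of finite partial sums.\<close>

lemma infsum_ennreal_eq:
  fixes f :: "'i \<Rightarrow> real"
  assumes "f summable_on A" "\<And>i. i \<in> A \<Longrightarrow> 0 \<le> f i"
  shows "(\<Sum>\<^sub>\<infinity>i\<in>A. ennreal (f i)) = ennreal (infsum f A)"
proof -
  have "infsum (ennreal \<circ> f) A = ennreal (infsum f A)"
  proof (rule infsum_comm_additive_general)
    show "sum (ennreal \<circ> f) F = ennreal (sum f F)" if "F \<subseteq> A" for F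
      using that assms(2) by (auto simp: o_def intro!: sum_ennreal)
  qed (use assms(1) in auto)
  then show ?thesis by (simp add: o_def)
qed

text \<open>A finite total bounds every finite partial sum. This extracts real summability from the
  upper frame bound and, by contraposition, recognises infinite sums.\<close>

lemma summable_on_if_infsum_ennreal_finite:
  fixes f :: "'i \<Rightarrow> real"
  assumes fin: "(\<Sum>\<^sub>\<infinity>i\<in>A. ennreal (f i)) \<noteq> \<infinity>" and f: "\<And>i. i \<in> A \<Longrightarrow> 0 \<le> f i"
  shows "f summable_on A"
proof (rule nonneg_bdd_above_summable_on)
  obtain r where r: "(\<Sum>\<^sub>\<infinity>i\<in>A. ennreal (f i)) = ennreal r" "0 \<le> r"
    using fin by (cases "\<Sum>\<^sub>\<infinity>i\<in>A. ennreal (f i)") (auto simp: infinity_ennreal_def)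
  have "sum f F \<le> r" if F: "F \<subseteq> A" "finite F" for F
  proof -
    have "ennreal (sum f F) = (\<Sum>i\<in>F. ennreal (f i))"
      using F f by (intro sum_ennreal[symmetric]) auto
    also have "\<dots> \<le> (\<Sum>\<^sub>\<infinity>i\<in>A. ennreal (f i))"
      unfolding infsum_finite[OF F(2), symmetric] using F by (intro infsum_mono_neutral nonneg_summable_on_complete) auto
    finally show ?thesis using r by simp
  qed
  then show "bdd_above (sum f ` {F. F \<subseteq> A \<and> finite F})"
    by (intro bdd_aboveI2) auto
qed (use f in auto)

text \<open>The finite Cauchy-Schwarz inequality holds on every finite subset with a right-hand side
  independent of that subset; both claims follow from this uniform bound. The index set is arbitrary
  so that tails of a series are covered too.\<close>

lemma
  fixes u :: "'i \<Rightarrow> complex" and a b :: "'i \<Rightarrow> real"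
  assumes a: "(\<lambda>i. (a i)\<^sup>2) summable_on J" and b: "(\<lambda>i. (b i)\<^sup>2) summable_on J"
    and u: "\<And>i. i \<in> J \<Longrightarrow> cmod (u i) \<le> \<bar>a i\<bar> * \<bar>b i\<bar>"
  shows abs_summable_on_product: "(\<lambda>i. cmod (u i)) summable_on J"
    and infsum_Cauchy_Schwarz:
      "cmod (infsum u J) \<le> sqrt (\<Sum>\<^sub>\<infinity>i\<in>J. (a i)\<^sup>2) * sqrt (\<Sum>\<^sub>\<infinity>i\<in>J. (b i)\<^sup>2)"
proof -
  have L2_le: "L2_set c F \<le> sqrt (\<Sum>\<^sub>\<infinity>i\<in>J. (c i)\<^sup>2)"
    if "(\<lambda>i. (c i)\<^sup>2) summable_on J" "finite F" "F \<subseteq> J" for c :: "'i \<Rightarrow> real" and F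
    unfolding L2_set_def using that by (intro real_sqrt_le_mono finite_sum_le_infsum) auto
  have le: "(\<Sum>i\<in>F. cmod (u i)) \<le> sqrt (\<Sum>\<^sub>\<infinity>i\<in>J. (a i)\<^sup>2) * sqrt (\<Sum>\<^sub>\<infinity>i\<in>J. (b i)\<^sup>2)"
    if F: "finite F" "F \<subseteq> J" for F
  proof -
    have "(\<Sum>i\<in>F. cmod (u i)) \<le> (\<Sum>i\<in>F. \<bar>a i\<bar> * \<bar>b i\<bar>)"
      using u F by (intro sum_mono) auto
    also have "\<dots> \<le> L2_set a F * L2_set b F"
      by (rule L2_set_mult_ineq)
    also have "\<dots> \<le> sqrt (\<Sum>\<^sub>\<infinity>i\<in>J. (a i)\<^sup>2) * sqrt (\<Sum>\<^sub>\<infinity>i\<in>J. (b i)\<^sup>2)"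
      by (intro mult_mono L2_le a b F real_sqrt_ge_zero infsum_nonneg L2_set_nonneg) auto
    finally show ?thesis .
  qed
  then show *: "(\<lambda>i. cmod (u i)) summable_on J"
    by (intro nonneg_bdd_above_summable_on bdd_aboveI2) auto
  show "cmod (infsum u J) \<le> sqrt (\<Sum>\<^sub>\<infinity>i\<in>J. (a i)\<^sup>2) * sqrt (\<Sum>\<^sub>\<infinity>i\<in>J. (b i)\<^sup>2)"
    using norm_infsum_bound[OF *] infsum_le_finite_sums[OF *] le by (meson order_trans)
qed

lemma has_sum_diff:
  fixes u v :: "'i \<Rightarrow> 'a::real_normed_algebra_1"
  assumes "(u has_sum a) J" "(v has_sum b) J"
  shows "((\<lambda>i. u i - v i) has_sum (a - b)) J"
  using has_sum_add[OF assms(1) has_sum_uminusI[OF assms(2)]] by simp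

section \<open>The frame operator\<close>

text \<open>
  The controlled g-frame is the case \<open>T i = \<Lambda>\<^sub>i C\<close>, \<open>T' i = C\<^sup>* \<Lambda>\<^sub>i\<^sup>*\<close>; then \<open>frame_form x y\<close> below is
  \<open>\<langle>S\<^sub>C x, y\<rangle>\<close>.
\<close>
locale operator_frame = hilbert_space K H
  for K :: "complex set" and H :: "('a, 'm) inner_module_scheme" (structure) +
  fixes I :: "'i set" and L :: "'i \<Rightarrow> ('b, 'n) inner_module_scheme"
    and T :: "'i \<Rightarrow> 'a \<Rightarrow> 'b" and T' :: "'i \<Rightarrow> 'b \<Rightarrow> 'a" and A B :: real
  assumes L: "i \<in> I \<Longrightarrow> hilbert_space K (L i)"
    and T_closed: "\<lbrakk>i \<in> I; x \<in> carrier H\<rbrakk> \<Longrightarrow> T i x \<in> carrier (L i)"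
    and T_add: "\<lbrakk>i \<in> I; x \<in> carrier H; y \<in> carrier H\<rbrakk> \<Longrightarrow> T i (x \<oplus>\<^bsub>H\<^esub> y) = T i x \<oplus>\<^bsub>L i\<^esub> T i y"
    and T_smult: "\<lbrakk>i \<in> I; a \<in> K; x \<in> carrier H\<rbrakk> \<Longrightarrow> T i (a \<odot>\<^bsub>H\<^esub> x) = a \<odot>\<^bsub>L i\<^esub> T i x"
    and T'_closed: "\<lbrakk>i \<in> I; v \<in> carrier (L i)\<rbrakk> \<Longrightarrow> T' i v \<in> carrier H"
    and iprod_T': "\<lbrakk>i \<in> I; x \<in> carrier H; v \<in> carrier (L i)\<rbrakk>
      \<Longrightarrow> iprod H x (T' i v) = iprod (L i) (T i x) v"
    and lower_pos: "0 < A"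
    and lower_le_upper: "A \<le> B"
    and summable_T: "x \<in> carrier H \<Longrightarrow> (\<lambda>i. (hnorm (L i) (T i x))\<^sup>2) summable_on I"
    and lower: "x \<in> carrier H \<Longrightarrow> A * (hnorm H x)\<^sup>2 \<le> (\<Sum>\<^sub>\<infinity>i\<in>I. (hnorm (L i) (T i x))\<^sup>2)"
    and upper: "x \<in> carrier H \<Longrightarrow> (\<Sum>\<^sub>\<infinity>i\<in>I. (hnorm (L i) (T i x))\<^sup>2) \<le> B * (hnorm H x)\<^sup>2"
begin

section \<open>The frame form and its bounds\<close>

lemma iprod_T'_left:
  assumes "i \<in> I" "x \<in> carrier H" "y \<in> carrier (L i)"
  shows "iprod H (T' i y) x = iprod (L i) y (T i x)"
proof -
  interpret Li: hilbert_space K "L i" using assms L by blast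
  show ?thesis
    using iprod_commute[OF assms(2) T'_closed[OF assms(1,3)]]
      Li.iprod_commute[OF T_closed[OF assms(1,2)] assms(3)] iprod_T'[OF assms] by simp
qed

lemma cmod_iprod_T_le:
  assumes "i \<in> I" "x \<in> carrier H" "y \<in> carrier H"
  shows "cmod (iprod (L i) (T i x) (T i y)) \<le> \<bar>hnorm (L i) (T i x)\<bar> * \<bar>hnorm (L i) (T i y)\<bar>"
proof -
  interpret Li: hilbert_space K "L i" using assms L by blast
  show ?thesis using Li.Cauchy_Schwarz[of "T i x" "T i y"] T_closed assms by simp
qed

definition frame_form :: "'a \<Rightarrow> 'a \<Rightarrow> complex" where
  "frame_form x y = (\<Sum>\<^sub>\<infinity>i\<in>I. iprod (L i) (T i x) (T i y))"

lemma summable_frame_form: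
  assumes "x \<in> carrier H" "y \<in> carrier H"
  shows "(\<lambda>i. iprod (L i) (T i x) (T i y)) summable_on I"
proof (rule abs_summable_summable)
  show "(\<lambda>i. cmod (iprod (L i) (T i x) (T i y))) summable_on I"
    using assms by (intro abs_summable_on_product[OF summable_T[OF assms(1)] summable_T[OF assms(2)]]
        cmod_iprod_T_le)
qed

lemma frame_form_add:
  assumes "x \<in> carrier H" "y \<in> carrier H" "z \<in> carrier H"
  shows "frame_form (x \<oplus>\<^bsub>H\<^esub> y) z = frame_form x z + frame_form y z"
proof -
  have eq: "iprod (L i) (T i (x \<oplus>\<^bsub>H\<^esub> y)) (T i z)
      = iprod (L i) (T i x) (T i z) + iprod (L i) (T i y) (T i z)" if i: "i \<in> I" for i
  proof -
    interpret Li: hilbert_space K "L i" using i L by blast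
    show ?thesis
      unfolding T_add[OF i assms(1,2)] by (intro Li.iprod_add T_closed i assms)
  qed
  have "frame_form (x \<oplus>\<^bsub>H\<^esub> y) z
      = (\<Sum>\<^sub>\<infinity>i\<in>I. iprod (L i) (T i x) (T i z) + iprod (L i) (T i y) (T i z))"
    unfolding frame_form_def by (rule infsum_cong, rule eq)
  also have "\<dots> = frame_form x z + frame_form y z"
    unfolding frame_form_def using summable_frame_form assms by (intro infsum_add)
  finally show ?thesis .
qed

lemma frame_form_smult:
  assumes "a \<in> K" "x \<in> carrier H" "y \<in> carrier H"
  shows "frame_form (a \<odot>\<^bsub>H\<^esub> x) y = a * frame_form x y"
proof -
  have eq: "iprod (L i) (T i (a \<odot>\<^bsub>H\<^esub> x)) (T i y) = a * iprod (L i) (T i x) (T i y)" if i: "i \<in> I" for i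
  proof -
    interpret Li: hilbert_space K "L i" using i L by blast
    show ?thesis
      unfolding T_smult[OF i assms(1,2)] by (intro Li.iprod_smult T_closed i assms)
  qed
  show ?thesis
    unfolding frame_form_def by (subst infsum_cmult_right'[symmetric]) (rule infsum_cong, rule eq)
qed

lemma frame_form_commute:
  assumes "x \<in> carrier H" "y \<in> carrier H"
  shows "frame_form y x = cnj (frame_form x y)"
proof -
  have eq: "iprod (L i) (T i y) (T i x) = cnj (iprod (L i) (T i x) (T i y))" if i: "i \<in> I" for i
  proof -
    interpret Li: hilbert_space K "L i" using i L by blast
    show ?thesis by (intro Li.iprod_commute T_closed i assms)
  qed
  show ?thesis
    unfolding frame_form_def infsum_cnj[symmetric] by (rule infsum_cong, rule eq)
qed

text \<open>In the real case, membership in the reals is invariance under conjugation, which passes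
  through infinite sums.\<close>

lemma frame_form_closed:
  assumes "x \<in> carrier H" "y \<in> carrier H"
  shows "frame_form x y \<in> K"
  using scalars
proof
  assume K: "K = \<real>"
  have eq: "cnj (iprod (L i) (T i x) (T i y)) = iprod (L i) (T i x) (T i y)" if i: "i \<in> I" for i
  proof -
    interpret Li: hilbert_space K "L i" using i L by blast
    show ?thesis
      using Li.iprod_closed[of "T i x" "T i y"] T_closed assms i by (simp add: K Reals_cnj_iff)
  qed
  have "cnj (frame_form x y) = frame_form x y"
    unfolding frame_form_def infsum_cnj[symmetric] by (rule infsum_cong, rule eq)
  then show ?thesis by (simp add: K Reals_cnj_iff)
qed simp

lemma frame_form_self:
  assumes "x \<in> carrier H"
  shows "frame_form x x = complex_of_real (\<Sum>\<^sub>\<infinity>i\<in>I. (hnorm (L i) (T i x))\<^sup>2)"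
proof -
  have eq: "iprod (L i) (T i x) (T i x) = complex_of_real ((hnorm (L i) (T i x))\<^sup>2)" if i: "i \<in> I" for i
  proof -
    interpret Li: hilbert_space K "L i" using i L by blast
    show ?thesis by (intro Li.iprod_self T_closed i assms)
  qed
  have "((\<lambda>i. iprod (L i) (T i x) (T i x))
      has_sum complex_of_real (\<Sum>\<^sub>\<infinity>i\<in>I. (hnorm (L i) (T i x))\<^sup>2)) I"
    using has_sum_of_real[OF has_sum_infsum[OF summable_T[OF assms]]] by (simp add: eq cong: has_sum_cong)
  then show ?thesis unfolding frame_form_def by (rule infsumI)
qed

text \<open>Cauchy-Schwarz over \<open>I\<close> leaves one factor \<open>sqrt B\<close> from each
  argument; 0 < A \<le> B makes their product \<open>B\<close>.\<close>

lemma frame_form_bound: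
  assumes "x \<in> carrier H" "y \<in> carrier H"
  shows "cmod (frame_form x y) \<le> B * (hnorm H x * hnorm H y)"
proof -
  have "cmod (frame_form x y) \<le> sqrt (\<Sum>\<^sub>\<infinity>i\<in>I. (hnorm (L i) (T i x))\<^sup>2)
      * sqrt (\<Sum>\<^sub>\<infinity>i\<in>I. (hnorm (L i) (T i y))\<^sup>2)"
    unfolding frame_form_def using assms summable_T cmod_iprod_T_le by (intro infsum_Cauchy_Schwarz)
  also have "\<dots> \<le> sqrt (B * (hnorm H x)\<^sup>2) * sqrt (B * (hnorm H y)\<^sup>2)"
    using assms upper lower_pos lower_le_upper
    by (intro mult_mono real_sqrt_le_mono real_sqrt_ge_zero infsum_nonneg) auto
  also have "\<dots> = sqrt B * sqrt B * (hnorm H x * hnorm H y)"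
    using assms by (simp add: real_sqrt_mult)
  also have "\<dots> = B * (hnorm H x * hnorm H y)"
    using lower_pos lower_le_upper by simp
  finally show ?thesis .
qed

text \<open>
  Applying Cauchy-Schwarz to the form on \<open>I - F\<close> bounds the error of the partial sum over \<open>F\<close>
  by the tail of \<open>\<Sum>\<^sub>\<infinity>i\<in>I. (hnorm (L i) (T i x))\<^sup>2\<close>.
\<close>
lemma has_usum_if_represents_frame_form:
  assumes x: "x \<in> carrier H" and z: "z \<in> carrier H"
    and rep: "\<And>y. y \<in> carrier H \<Longrightarrow> iprod H z y = frame_form x y"
  shows "has_usum H (\<lambda>i. T' i (T i x)) I z"
proof -
  define u where "u = (\<lambda>i. T' i (T i x))"
  define p where "p = (\<lambda>i. (hnorm (L i) (T i x))\<^sup>2)"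
  have u: "u \<in> I \<rightarrow> carrier H" using T'_closed T_closed x by (auto simp: u_def)
  have sum_closed: "finsum H u F \<in> carrier H" if "F \<subseteq> I" for F
    using u that by (intro finsum_closed) auto
  have bound: "hdist H (finsum H u F) z \<le> sqrt (infsum p I - sum p F) * sqrt B"
    if F: "finite F" "F \<subseteq> I" for F
  proof -
    define d where "d = finsum H u F \<ominus>\<^bsub>H\<^esub> z"
    have d: "d \<in> carrier H" using sum_closed F z by (simp add: d_def)
    \<comment> \<open>The error \<open>d\<close> is tested against itself: the partial sum
      contributes \<open>sum v F\<close> and \<open>z\<close> contributes \<open>infsum v I\<close>,
      so ||d||^2 is minus the sum of \<open>v\<close> over I - F.\<close>
    define v where "v = (\<lambda>i. iprod (L i) (T i x) (T i d))"
    have summable_diff: "h summable_on (I - F)" if "h summable_on I" for h :: "'i \<Rightarrow> real"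
      using that F by (intro summable_on_Diff) auto
    have "iprod H (finsum H u F) d = sum v F"
      using u F d T_closed x
      by (subst iprod_finsum) (auto simp: u_def v_def iprod_T'_left intro!: sum.cong)
    moreover have "infsum v (I - F) = infsum v I - sum v F"
      using infsum_Diff[of v I F] summable_frame_form[OF x d] F by (simp add: v_def)
    moreover have "infsum v I = iprod H z d"
      using rep[OF d] by (simp add: v_def frame_form_def)
    ultimately have "iprod H d d = - infsum v (I - F)"
      using iprod_minus[of "finsum H u F" z d] sum_closed F z d by (simp flip: d_def)
    then have "(hnorm H d)\<^sup>2 \<le> cmod (infsum v (I - F))"
      using iprod_self[OF d] by (metis abs_of_nonneg norm_minus_cancel norm_of_real order_refl zero_le_power2)
    also have "\<dots> \<le> sqrt (infsum p (I - F)) * sqrt (\<Sum>\<^sub>\<infinity>i\<in>I - F. (hnorm (L i) (T i d))\<^sup>2)"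
      unfolding p_def v_def using x d cmod_iprod_T_le
      by (intro infsum_Cauchy_Schwarz summable_diff summable_T) auto
    also have "\<dots> \<le> sqrt (infsum p (I - F)) * sqrt (B * (hnorm H d)\<^sup>2)"
    proof (intro mult_left_mono real_sqrt_le_mono)
      have "(\<Sum>\<^sub>\<infinity>i\<in>I - F. (hnorm (L i) (T i d))\<^sup>2) \<le> (\<Sum>\<^sub>\<infinity>i\<in>I. (hnorm (L i) (T i d))\<^sup>2)"
        using summable_T[OF d] summable_diff by (intro infsum_mono_neutral) auto
      also have "\<dots> \<le> B * (hnorm H d)\<^sup>2" by (rule upper[OF d])
      finally show "(\<Sum>\<^sub>\<infinity>i\<in>I - F. (hnorm (L i) (T i d))\<^sup>2) \<le> B * (hnorm H d)\<^sup>2" .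
    qed (auto simp: p_def intro: infsum_nonneg)
    also have "\<dots> = (sqrt (infsum p (I - F)) * sqrt B) * hnorm H d"
      using d by (simp add: real_sqrt_mult)
    finally have "hnorm H d * hnorm H d \<le> (sqrt (infsum p (I - F)) * sqrt B) * hnorm H d"
      by (simp add: power2_eq_square)
    moreover have "0 \<le> sqrt (infsum p (I - F)) * sqrt B"
      using lower_pos lower_le_upper
      by (intro mult_nonneg_nonneg real_sqrt_ge_zero infsum_nonneg) (auto simp: p_def)
    \<comment> \<open>One factor ||d|| is cancelled; when it is zero, the claim is nonnegativity of
      the right-hand side.\<close>
    ultimately have "hnorm H d \<le> sqrt (infsum p (I - F)) * sqrt B"
      using hnorm_nonneg[OF d] by (auto simp: mult_le_cancel_right)
    moreover have "infsum p (I - F) = infsum p I - sum p F"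
      using infsum_Diff[of p I F] summable_T[OF x] F by (simp add: p_def)
    ultimately show ?thesis using sum_closed[OF F(2)] z by (simp add: hdist_def d_def)
  qed
  have "((\<lambda>F. sqrt (infsum p I - sum p F) * sqrt B) \<longlongrightarrow> sqrt (infsum p I - infsum p I) * sqrt B)
      (finite_subsets_at_top I)"
    using summable_T[OF x] unfolding p_def by (intro tendsto_intros infsum_tendsto)
  then have lim: "((\<lambda>F. sqrt (infsum p I - sum p F) * sqrt B) \<longlongrightarrow> 0) (finite_subsets_at_top I)"
    by simp
  have "((\<lambda>F. hdist H (finsum H u F) z) \<longlongrightarrow> 0) (finite_subsets_at_top I)"
  proof (rule Lim_null_comparison[OF _ lim])
    have "norm (hdist H (finsum H u F) z) \<le> sqrt (infsum p I - sum p F) * sqrt B"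
      if "finite F" "F \<subseteq> I" for F
      using bound[OF that] sum_closed[OF that(2)] z by (simp add: hdist_def)
    then show "\<forall>\<^sub>F F in finite_subsets_at_top I.
        norm (hdist H (finsum H u F) z) \<le> sqrt (infsum p I - sum p F) * sqrt B"
      by (intro eventually_finite_subsets_at_top_weakI)
  qed
  moreover have "\<forall>\<^sub>F F in finite_subsets_at_top I. finsum H u F \<in> carrier H"
    using sum_closed by (intro eventually_finite_subsets_at_top_weakI)
  ultimately show ?thesis
    using u z by (simp add: has_usum_def limitin_htopology flip: u_def)
qed

text \<open>Riesz representation finds the candidate for the sum before convergence is known. The
  form is linear in its first slot, so \<open>x\<close> is held in the second and conjugate symmetry
  swaps them back.\<close>

lemma ex_has_usum_frame:
  assumes x: "x \<in> carrier H"
  shows "\<exists>z\<in>carrier H. has_usum H (\<lambda>i. T' i (T i x)) I z"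
proof -
  have "\<exists>z\<in>carrier H. \<forall>y\<in>carrier H. frame_form y x = iprod H y z"
  proof (rule Riesz_representation)
    show "cmod (frame_form y x) \<le> (B * hnorm H x) * hnorm H y" if "y \<in> carrier H" for y
      using frame_form_bound[OF that x] by (simp add: mult_ac)
  qed (use x frame_form_closed frame_form_add frame_form_smult in auto)
  then obtain z where z: "z \<in> carrier H" "\<And>y. y \<in> carrier H \<Longrightarrow> frame_form y x = iprod H y z"
    by blast
  have "iprod H z y = frame_form x y" if "y \<in> carrier H" for y
    using z(2)[OF that] iprod_commute[OF that z(1)] frame_form_commute[OF that x] by simp
  with x z(1) show ?thesis
    by (intro bexI[of _ z] has_usum_if_represents_frame_form)
qed

text \<open>Here the sum \<open>f\<close> is given and \<open>x\<close> is sought: <_, f> is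
  represented through the frame form instead of the inner product, with the lower frame bound as
  coercivity.\<close>

lemma frame_op_surj:
  assumes f: "f \<in> carrier H"
  shows "\<exists>x\<in>carrier H. has_usum H (\<lambda>i. T' i (T i x)) I f"
proof -
  have "\<exists>x\<in>carrier H. \<forall>y\<in>carrier H. iprod H y f = frame_form y x"
  proof (rule coercive_form_representation[where A = A and B = B and M = "hnorm H f"])
    show "A * (hnorm H x)\<^sup>2 \<le> Re (frame_form x x)" if "x \<in> carrier H" for x
      using lower[OF that] that by (simp add: frame_form_self)
    show "cmod (iprod H x f) \<le> hnorm H f * hnorm H x" if "x \<in> carrier H" for x
      using Cauchy_Schwarz[OF that f] by (simp add: mult.commute)
  qed (use f in \<open>simp_all add: frame_form_closed frame_form_add frame_form_smult frame_form_bound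
        lower_pos iprod_closed iprod_add iprod_smult frame_form_commute[symmetric]\<close>)
  then obtain x where "x \<in> carrier H" "\<And>y. y \<in> carrier H \<Longrightarrow> iprod H y f = frame_form y x"
    by blast
  note x = this
  have "iprod H f y = frame_form x y" if "y \<in> carrier H" for y
    using x(2)[OF that] iprod_commute[OF that f] frame_form_commute[OF that x(1)] by simp
  with f x(1) show ?thesis
    by (intro bexI[of _ x] has_usum_if_represents_frame_form)
qed

text \<open>
  Both representations of \<open>f\<close> have the same inner product with \<open>x\<close>, so \<open>g i \<ominus> T i x\<close> is orthogonal
  to \<open>T i x\<close> after summation over \<open>I\<close>.
\<close>
lemma infsum_norm_decomposition:
  assumes x: "x \<in> carrier H" and g: "\<And>i. i \<in> I \<Longrightarrow> g i \<in> carrier (L i)"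
    and f_g: "has_usum H (\<lambda>i. T' i (g i)) I f" and f_x: "has_usum H (\<lambda>i. T' i (T i x)) I f"
  shows "(\<Sum>\<^sub>\<infinity>i\<in>I. ennreal ((hnorm (L i) (g i))\<^sup>2))
       = (\<Sum>\<^sub>\<infinity>i\<in>I. ennreal ((hnorm (L i) (T i x))\<^sup>2))
         + (\<Sum>\<^sub>\<infinity>i\<in>I. ennreal ((hnorm (L i) (g i \<ominus>\<^bsub>L i\<^esub> T i x))\<^sup>2))"
proof -
  define q where "q = (\<lambda>i. (hnorm (L i) (g i))\<^sup>2)"
  define p where "p = (\<lambda>i. (hnorm (L i) (T i x))\<^sup>2)"
  define d where "d = (\<lambda>i. (hnorm (L i) (g i \<ominus>\<^bsub>L i\<^esub> T i x))\<^sup>2)"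
  \<comment> \<open>\<open>r i\<close> is the real part of <T i x - g i, T i x>, the cross term of
    Pythagoras; its sum is Re <f, x> - Re <f, x> = 0.\<close>
  define r where "r = (\<lambda>i. Re (iprod (L i) (T i x) (T i x)) - Re (iprod (L i) (g i) (T i x)))"
  have "((\<lambda>i. iprod H (T' i (T i x)) x - iprod H (T' i (g i)) x) has_sum iprod H f x - iprod H f x) I"
    using has_usum_iprod[OF f_x x] has_usum_iprod[OF f_g x] by (rule has_sum_diff)
  then have "((\<lambda>i. Re (iprod H (T' i (T i x)) x - iprod H (T' i (g i)) x)) has_sum 0) I"
    using has_sum_Re by fastforce
  then have r: "(r has_sum 0) I"
    using iprod_T'_left[OF _ x] g T_closed x by (simp add: r_def cong: has_sum_cong)
  have eq: "q i = p i + d i - 2 * r i" if i: "i \<in> I" for i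
  proof -
    interpret Li: hilbert_space K "L i" using i L by blast
    show ?thesis
      using Li.hnorm_minus_power2[OF g[OF i] T_closed[OF i x]] Li.hnorm_power2[OF T_closed[OF i x]]
      by (simp add: q_def p_def d_def r_def)
  qed
  have p: "(p has_sum infsum p I) I"
    using summable_T[OF x] unfolding p_def by (rule has_sum_infsum)
  have nonneg: "0 \<le> q i" "0 \<le> p i" "0 \<le> d i" for i
    by (simp_all add: q_def p_def d_def)
  have r2: "((\<lambda>i. 2 * r i) has_sum 0) I"
    using has_sum_cmult_right[OF r, of 2] by simp
  show ?thesis
  \<comment> \<open>Since \<open>p\<close> and \<open>r\<close> are summable, \<open>q\<close> and
    \<open>d\<close> are summable together. Otherwise both sides of the identity are
    infinite.\<close>
  proof (cases "d summable_on I")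
    case True
    have "((\<lambda>i. p i + d i - 2 * r i) has_sum infsum p I + infsum d I) I"
      using has_sum_diff[OF has_sum_add[OF p has_sum_infsum[OF True]] r2] by simp
    then have q: "(q has_sum infsum p I + infsum d I) I"
      using eq by (simp cong: has_sum_cong)
    have "(\<Sum>\<^sub>\<infinity>i\<in>I. ennreal (q i)) = ennreal (infsum p I + infsum d I)"
      using q infsum_ennreal_eq[of q I] nonneg by (auto simp: summable_on_def infsumI)
    also have "\<dots> = (\<Sum>\<^sub>\<infinity>i\<in>I. ennreal (p i)) + (\<Sum>\<^sub>\<infinity>i\<in>I. ennreal (d i))"
      using True summable_T[OF x] nonneg
      by (simp add: infsum_ennreal_eq infsum_nonneg ennreal_plus flip: p_def)
    finally show ?thesis by (simp add: p_def q_def d_def)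
  next
    case False
    have "\<not> q summable_on I"
    proof
      assume "q summable_on I"
      then have "(\<lambda>i. q i - p i + 2 * r i) summable_on I"
        using has_sum_add[OF has_sum_diff[OF has_sum_infsum p] r2] by (blast intro: has_sum_imp_summable)
      moreover have "q i - p i + 2 * r i = d i" if "i \<in> I" for i using eq[OF that] by simp
      ultimately show False using False by (simp cong: summable_on_cong)
    qed
    then have "(\<Sum>\<^sub>\<infinity>i\<in>I. ennreal (q i)) = \<infinity>" "(\<Sum>\<^sub>\<infinity>i\<in>I. ennreal (d i)) = \<infinity>"
      using False summable_on_if_infsum_ennreal_finite nonneg by blast+
    then show ?thesis by (simp add: p_def q_def d_def infinity_ennreal_def)
  qed
qed

end

section \<open>From controlled g-frames to operator frames, and the norm identity\<close>

lemma controlled_gframe_operator_frame: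
  assumes H: "hilbert_space K H" and L: "\<And>i. i \<in> I \<Longrightarrow> hilbert_space K (L i)"
    and C: "C \<in> bounded_ops K H H" and frame: "controlled_gframe K H I L C \<Lambda>"
  shows "\<exists>A B. operator_frame K H I L (\<lambda>i x. \<Lambda> i (C x))
    (\<lambda>i y. adj H H C (adj H (L i) (\<Lambda> i) y)) A B"
proof -
  interpret hilbert_space K H by (rule H)
  obtain A B where A: "0 < A" "A \<le> B" and
    bounds: "\<And>x. x \<in> carrier H \<Longrightarrow> ennreal (A * (hnorm H x)\<^sup>2)
        \<le> (\<Sum>\<^sub>\<infinity>i\<in>I. ennreal (Re (iprod (L i) (\<Lambda> i (C x)) (\<Lambda> i (C x)))))"
      "\<And>x. x \<in> carrier H \<Longrightarrow> (\<Sum>\<^sub>\<infinity>i\<in>I. ennreal (Re (iprod (L i) (\<Lambda> i (C x)) (\<Lambda> i (C x)))))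
        \<le> ennreal (B * (hnorm H x)\<^sup>2)"
    and \<Lambda>: "\<And>i. i \<in> I \<Longrightarrow> \<Lambda> i \<in> bounded_ops K H (L i)"
    using frame unfolding controlled_gframe_def by blast
  have C_closed: "x \<in> carrier H \<Longrightarrow> C x \<in> carrier H" for x
    using C by (auto simp: bounded_ops_def)
  have \<Lambda>_closed: "\<lbrakk>i \<in> I; x \<in> carrier H\<rbrakk> \<Longrightarrow> \<Lambda> i x \<in> carrier (L i)" for i x
    using \<Lambda>[of i] unfolding bounded_ops_def by blast
  have sum_eq: "(\<Sum>\<^sub>\<infinity>i\<in>I. ennreal (Re (iprod (L i) (\<Lambda> i (C x)) (\<Lambda> i (C x)))))
      = (\<Sum>\<^sub>\<infinity>i\<in>I. ennreal ((hnorm (L i) (\<Lambda> i (C x)))\<^sup>2))" if x: "x \<in> carrier H" for x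
  proof (intro infsum_cong)
    fix i assume i: "i \<in> I"
    interpret Li: hilbert_space K "L i" using i L by blast
    show "ennreal (Re (iprod (L i) (\<Lambda> i (C x)) (\<Lambda> i (C x)))) = ennreal ((hnorm (L i) (\<Lambda> i (C x)))\<^sup>2)"
      using Li.hnorm_power2 \<Lambda>_closed[OF i C_closed[OF x]] by simp
  qed
  have summable: "(\<lambda>i. (hnorm (L i) (\<Lambda> i (C x)))\<^sup>2) summable_on I" if x: "x \<in> carrier H" for x
    using bounds(2)[OF x] unfolding sum_eq[OF x]
    by (intro summable_on_if_infsum_ennreal_finite) (auto simp: top_unique infinity_ennreal_def)
  have real_eq: "(\<Sum>\<^sub>\<infinity>i\<in>I. ennreal ((hnorm (L i) (\<Lambda> i (C x)))\<^sup>2))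
      = ennreal (\<Sum>\<^sub>\<infinity>i\<in>I. (hnorm (L i) (\<Lambda> i (C x)))\<^sup>2)" if x: "x \<in> carrier H" for x
    by (intro infsum_ennreal_eq summable x) simp
  have "operator_frame K H I L (\<lambda>i x. \<Lambda> i (C x)) (\<lambda>i y. adj H H C (adj H (L i) (\<Lambda> i) y)) A B"
  proof (intro operator_frame.intro operator_frame_axioms.intro H)
    fix i x y a assume i: "i \<in> I"
    show "\<lbrakk>x \<in> carrier H; y \<in> carrier H\<rbrakk>
        \<Longrightarrow> \<Lambda> i (C (x \<oplus>\<^bsub>H\<^esub> y)) = \<Lambda> i (C x) \<oplus>\<^bsub>L i\<^esub> \<Lambda> i (C y)"
      using C \<Lambda>[OF i] C_closed by (simp add: bounded_ops_def)
    show "\<lbrakk>a \<in> K; x \<in> carrier H\<rbrakk> \<Longrightarrow> \<Lambda> i (C (a \<odot>\<^bsub>H\<^esub> x)) = a \<odot>\<^bsub>L i\<^esub> \<Lambda> i (C x)"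
      using C \<Lambda>[OF i] C_closed by (simp add: bounded_ops_def)
  next
    fix i y assume i: "i \<in> I" and y: "y \<in> carrier (L i)"
    \<comment> \<open>The adjoint of the composite \<Lambda> i C is built in two stages: first the
      adjoint of \<Lambda> i, then that of \<open>C\<close> applied to the resulting vector.\<close>
    note adj1 = adj_spec[OF L[OF i] \<Lambda>[OF i] y]
    note adj2 = adj_spec[OF H C adj1(1)]
    show "adj H H C (adj H (L i) (\<Lambda> i) y) \<in> carrier H" by (rule adj2)
    fix x assume "x \<in> carrier H"
    then show "iprod H x (adj H H C (adj H (L i) (\<Lambda> i) y)) = iprod (L i) (\<Lambda> i (C x)) y"
      using adj1 adj2 C_closed by simp
  next
    fix x assume x: "x \<in> carrier H"
    \<comment> \<open>\<open>ennreal\<close> truncates negative reals to 0, so an inequality between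
      its values reflects back to the reals once the right-hand side is known to be
      nonnegative.\<close>
    have "0 \<le> (\<Sum>\<^sub>\<infinity>i\<in>I. (hnorm (L i) (\<Lambda> i (C x)))\<^sup>2)" by (intro infsum_nonneg) simp
    then show "A * (hnorm H x)\<^sup>2 \<le> (\<Sum>\<^sub>\<infinity>i\<in>I. (hnorm (L i) (\<Lambda> i (C x)))\<^sup>2)"
      using bounds(1)[OF x] unfolding sum_eq[OF x] real_eq[OF x] by simp
    show "(\<Sum>\<^sub>\<infinity>i\<in>I. (hnorm (L i) (\<Lambda> i (C x)))\<^sup>2) \<le> B * (hnorm H x)\<^sup>2"
      using bounds(2)[OF x] A unfolding sum_eq[OF x] real_eq[OF x] by simp
  qed (use L A summable \<Lambda>_closed C_closed in auto)
  then show ?thesis by blast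
qed

theorem theorem3p3:
  fixes K :: "complex set"
    and H :: "'a inner_module"
    and I :: "'i set"
    and L :: "'i \<Rightarrow> 'b inner_module"
    and C S :: "'a \<Rightarrow> 'a"
    and \<Lambda> \<Gamma> :: "'i \<Rightarrow> 'a \<Rightarrow> 'b"
    and f :: 'a
    and g :: "'i \<Rightarrow> 'b"
  assumes H: "hilbert_space K H" "separable_space (htopology H)"
    and L: "\<And>i. i \<in> I \<Longrightarrow> hilbert_space K (L i)"
    and C: "C \<in> bounded_ops K H H" "bij_betw C (carrier H) (carrier H)"
      "inv_op H C \<in> bounded_ops K H H"
    and frame: "controlled_gframe K H I L C \<Lambda>"
    and S: "S = controlled_gframe_op H I L C \<Lambda>"
    and \<Gamma>: "\<Gamma> = (\<lambda>i x. \<Lambda> i (C (inv_op H S x)))"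
    and f: "f \<in> carrier H"
    and g: "\<And>i. i \<in> I \<Longrightarrow> g i \<in> carrier (L i)"
    and repr: "has_usum H (\<lambda>i. adj H H C (adj H (L i) (\<Lambda> i) (g i))) I f"
  shows "(\<Sum>\<^sub>\<infinity>i\<in>I. ennreal ((hnorm (L i) (g i))\<^sup>2))
       = (\<Sum>\<^sub>\<infinity>i\<in>I. ennreal ((hnorm (L i) (\<Gamma> i f))\<^sup>2))
         + (\<Sum>\<^sub>\<infinity>i\<in>I. ennreal ((hnorm (L i) (g i \<ominus>\<^bsub>L i\<^esub> \<Gamma> i f))\<^sup>2))"
proof -
  obtain A B where "operator_frame K H I L (\<lambda>i x. \<Lambda> i (C x))
      (\<lambda>i y. adj H H C (adj H (L i) (\<Lambda> i) y)) A B"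
    using controlled_gframe_operator_frame[OF H(1) L C(1) frame] by blast
  then interpret operator_frame K H I L "\<lambda>i x. \<Lambda> i (C x)"
    "\<lambda>i y. adj H H C (adj H (L i) (\<Lambda> i) y)" A B .
  \<comment> \<open>\<open>S\<close> is a definite description, so its value is a sum of the series
    only after a sum has been shown to exist.\<close>
  have S_usum: "has_usum H (\<lambda>i. adj H H C (adj H (L i) (\<Lambda> i) (\<Lambda> i (C x)))) I (S x)"
    if x: "x \<in> carrier H" for x
  proof -
    obtain z where z: "has_usum H (\<lambda>i. adj H H C (adj H (L i) (\<Lambda> i) (\<Lambda> i (C x)))) I z"
      using ex_has_usum_frame[OF x] by blast
    moreover have "S x = z"
      unfolding S controlled_gframe_op_def by (rule has_usum_usum[OF z])
    ultimately show ?thesis by simp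
  qed
  define x where "x = inv_op H S f"
  \<comment> \<open>The preimage \<open>w\<close> places \<open>f\<close> in the range of
    \<open>S\<close>. Then \<open>inv_op H S f\<close> is an element of the carrier that
    \<open>S\<close> maps to \<open>f\<close>, without being identified with
    \<open>w\<close>.\<close>
  obtain w where w: "w \<in> carrier H"
    "has_usum H (\<lambda>i. adj H H C (adj H (L i) (\<Lambda> i) (\<Lambda> i (C w)))) I f"
    using frame_op_surj[OF f] by blast
  have "f = S w"
    unfolding S controlled_gframe_op_def by (rule has_usum_usum[OF w(2), symmetric])
  then have "f \<in> S ` carrier H" using w(1) by blast
  then have x: "x \<in> carrier H" and "S x = f"
    by (simp_all add: x_def inv_op_def inv_into_into f_inv_into_f)
  then have "has_usum H (\<lambda>i. adj H H C (adj H (L i) (\<Lambda> i) (\<Lambda> i (C x)))) I f"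
    using S_usum[OF x] by simp
  from infsum_norm_decomposition[OF x g repr this] show ?thesis
    unfolding \<Gamma> x_def .
qed

end
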